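(* Cycle $\mathbb{C}_n,n\geq 3$ is a compliant graph and $$d_{td}(a_i)=\begin{cases} \frac{n}{2} \quad &\text{ if } n\equiv 0 (mod4)\\ \frac{n+1}{2} \quad &\text{ if } n\equiv 1,3 (mod 4)\\ \frac{n}{2}+1 \quad &\text{ if } n\equiv 2 (mod 4) \end{cases}$$
   Context: For a graph without isolated vertices, a total dominating set (TDS) is a set $S$ of vertices such that every vertex is adjacent to some vertex of $S$; a minimal TDS (MTDS) is a TDS no proper subset of which is a TDS. A vertex is compliant if some MTDS contains it; a graph is compliant if all its vertices are compliant. For a vertex $a$ of a compliant graph, the total domination degree is $d_{td}(a)=\min\{|S| : S \text{ is an MTDS containing } a\}$. The cycle $\mathbb{C}_n$ has vertices $a_1,\dots,a_n$. *)

theory Defs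
  imports "Graph_Theory.Pair_Digraph"
begin

(* A finite simple graph is a pair_graph: a finite, loop-free set of ordered pairs that is
   symmetric, so (v, u) \<in> parcs G says that v and u are adjacent. *)

definition no_isolated_vertices :: "'a pair_pre_digraph \<Rightarrow> bool" where
  "no_isolated_vertices G \<longleftrightarrow> (\<forall>v\<in>pverts G. \<exists>u\<in>pverts G. (v, u) \<in> parcs G)"

definition total_dominating_set :: "'a pair_pre_digraph \<Rightarrow> 'a set \<Rightarrow> bool" where
  "total_dominating_set G S \<longleftrightarrow>
     S \<subseteq> pverts G \<and> (\<forall>v\<in>pverts G. \<exists>u\<in>S. (v, u) \<in> parcs G)"

definition minimal_TDS :: "'a pair_pre_digraph \<Rightarrow> 'a set \<Rightarrow> bool" where
  "minimal_TDS G S \<longleftrightarrow>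
     total_dominating_set G S \<and> (\<forall>T. T \<subset> S \<longrightarrow> \<not> total_dominating_set G T)"

definition compliant_vertex :: "'a pair_pre_digraph \<Rightarrow> 'a \<Rightarrow> bool" where
  "compliant_vertex G v \<longleftrightarrow> v \<in> pverts G \<and> (\<exists>S. minimal_TDS G S \<and> v \<in> S)"

definition compliant_graph :: "'a pair_pre_digraph \<Rightarrow> bool" where
  "compliant_graph G \<longleftrightarrow>
     pair_graph G \<and> no_isolated_vertices G \<and> (\<forall>v\<in>pverts G. compliant_vertex G v)"

(* For a compliant graph the set is finite and, for a vertex a, nonempty, so Min is its least
   element; outside that situation the value carries no meaning. *)
definition total_domination_degree :: "'a pair_pre_digraph \<Rightarrow> 'a \<Rightarrow> nat" where
  "total_domination_degree G a = Min {card S | S. minimal_TDS G S \<and> a \<in> S}"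

(* The vertex a_i is represented by the number i. The definition yields a cycle only for n \<ge> 3:
   for n = 1 it has a loop and for n = 2 it is a single edge. *)
definition cycle_graph :: "nat \<Rightarrow> nat pair_pre_digraph" where
  "cycle_graph n =
     \<lparr> pverts = {1..n},
       parcs = {(i, j). i \<in> {1..n} \<and> j \<in> {1..n} \<and>
                  (j = i + 1 \<or> i = j + 1 \<or> (i = 1 \<and> j = n) \<or> (i = n \<and> j = 1))} \<rparr>"

end

theory Submission
  imports Defs
begin

text \<open>
  A vertex of a cycle dominates at most two vertices, so a TDS has at least \<open>n/2\<close> elements. If
  \<open>n = 4k + 2\<close>, then adjacency changes the parity of the index, so the odd and the even elements of
  a TDS each have to dominate \<open>2k + 1\<close> vertices, and there are at least \<open>k + 1\<close> of either kind.
  Conversely, going around the cycle from any vertex \<open>a\<close> and taking the positions congruent to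
  \<open>0\<close> or \<open>1\<close> modulo \<open>4\<close> gives a TDS through \<open>a\<close> that attains the bound. A TDS of least cardinality
  is minimal, so this set is an MTDS.
\<close>

section \<open>Adjacency in the cycle\<close>

lemma in_parcs_cycle_graph:
  "(i, j) \<in> parcs (cycle_graph n) \<longleftrightarrow> i \<in> {1..n} \<and> j \<in> {1..n} \<and>
     (j = i + 1 \<or> i = j + 1 \<or> (i = 1 \<and> j = n) \<or> (i = n \<and> j = 1))"
  by (simp add: cycle_graph_def)

lemma pverts_cycle_graph [simp]: "pverts (cycle_graph n) = {1..n}"
  by (simp add: cycle_graph_def)

lemma cycle_graph_arc_sym:
  "(i, j) \<in> parcs (cycle_graph n) \<Longrightarrow> (j, i) \<in> parcs (cycle_graph n)"
  by (auto simp: in_parcs_cycle_graph)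

lemma cycle_graph_arc_successor:
  assumes "v \<in> {1..n}"
  shows "(v, v mod n + 1) \<in> parcs (cycle_graph n)"
  using assms by (cases "v = n") (auto simp: in_parcs_cycle_graph)

lemma pair_graph_cycle_graph:
  assumes "n \<ge> 3"
  shows "pair_graph (cycle_graph n)"
proof
  show "finite (parcs (cycle_graph n))"
    by (rule finite_subset[of _ "{1..n} \<times> {1..n}"]) (auto simp: in_parcs_cycle_graph)
  show "symmetric (with_proj (cycle_graph n))"
    by (auto simp: symmetric_def sym_def arcs_ends_def arc_to_ends_def intro: cycle_graph_arc_sym)
qed (use assms in \<open>auto simp: cycle_graph_def\<close>)

lemma no_isolated_vertices_cycle_graph: "no_isolated_vertices (cycle_graph n)"
  unfolding no_isolated_vertices_def pverts_cycle_graph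
  using cycle_graph_arc_successor in_parcs_cycle_graph by blast

section \<open>Counting dominated vertices: the lower bound\<close>

lemma card_neighbours_cycle_graph:
  "card {v. (v, u) \<in> parcs (cycle_graph n)} \<le> 2"
proof -
  let ?s = "if u = n then 1 else u + 1" and ?p = "if u = 1 then n else u - 1"
  have "{v. (v, u) \<in> parcs (cycle_graph n)} \<subseteq> {?s, ?p}"
    by (auto simp: in_parcs_cycle_graph)
  then have "card {v. (v, u) \<in> parcs (cycle_graph n)} \<le> card {?s, ?p}"
    by (intro card_mono) auto
  also have "\<dots> \<le> 2"
    by (auto simp: card_insert_if)
  finally show ?thesis .
qed

text \<open>The neighbourhoods of the elements of \<open>T\<close> cover \<open>W\<close>, and each
  has at most two elements. \<open>W\<close> is kept arbitrary so that the bound serves both the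
  whole vertex set and a single parity class.\<close>

lemma card_dominated_le:
  assumes "finite T" and "\<And>v. v \<in> W \<Longrightarrow> \<exists>u\<in>T. (v, u) \<in> parcs (cycle_graph n)"
  shows "card W \<le> 2 * card T"
proof -
  let ?N = "\<lambda>u. {v. (v, u) \<in> parcs (cycle_graph n)}"
  have "finite (?N u)" for u
    by (rule finite_subset[of _ "{1..n}"]) (auto simp: in_parcs_cycle_graph)
  then have "card W \<le> card (\<Union>u\<in>T. ?N u)"
    using assms by (intro card_mono) auto
  also have "\<dots> \<le> (\<Sum>u\<in>T. card (?N u))"
    using assms(1) by (rule card_UN_le)
  also have "\<dots> \<le> (\<Sum>u\<in>T. 2)"
    by (intro sum_mono card_neighbours_cycle_graph)
  finally show ?thesis
    by simp
qed

lemma card_odd_interval: "card {v \<in> {1..n}. odd v} = (n + 1) div 2"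
  and card_even_interval: "card {v \<in> {1..n}. even v} = n div 2"
proof -
  have "card {v \<in> {1..n}. odd v} = (n + 1) div 2 \<and> card {v \<in> {1..n}. even v} = n div 2"
  proof (induction n)
    case (Suc n)
    have "{v \<in> {1..Suc n}. P v} =
        (if P (Suc n) then insert (Suc n) {v \<in> {1..n}. P v} else {v \<in> {1..n}. P v})" for P
      by (auto simp: le_Suc_eq)
    with Suc show ?case
      by auto
  qed auto
  then show "card {v \<in> {1..n}. odd v} = (n + 1) div 2" "card {v \<in> {1..n}. even v} = n div 2"
    by auto
qed

text \<open>The closing edge joins 1 and \<open>n\<close>, which differ in parity exactly when
  \<open>n\<close> is even; an even cycle is bipartite.\<close>

lemma cycle_graph_arc_parity:
  assumes "even n" and "(v, u) \<in> parcs (cycle_graph n)"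
  shows "even v \<longleftrightarrow> odd u"
  using assms by (auto simp: in_parcs_cycle_graph)

text \<open>Counting the positions chosen by the construction makes the upper bound immediate; the
  closed form is derived separately.\<close>

definition total_domination_number_cycle :: "nat \<Rightarrow> nat" where
  "total_domination_number_cycle n = card {j. j < n \<and> j mod 4 < 2}"

text \<open>As \<open>n\<close> runs through the residues 0, 1, 2, 3, the left side grows by 2, 2,
  0, 0 at the next step, and so does the right side, whose correction term cycles through 0, 1, 2,
  1.\<close>

lemma twice_total_domination_number_cycle:
  "2 * total_domination_number_cycle n =
     n + (if n mod 4 = 0 then 0 else if n mod 4 = 2 then 2 else 1)"
  unfolding total_domination_number_cycle_def
proof (induction n)
  case (Suc n)
  have "{j. j < Suc n \<and> j mod 4 < 2} =
      (if n mod 4 < 2 then insert n {j. j < n \<and> j mod 4 < 2} else {j. j < n \<and> j mod 4 < 2})"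
    by (auto simp: less_Suc_eq)
  then have "card {j. j < Suc n \<and> j mod 4 < 2} =
      card {j. j < n \<and> j mod 4 < 2} + (if n mod 4 < 2 then 1 else 0)"
    by simp
  moreover have "n mod 4 = 0 \<or> n mod 4 = 1 \<or> n mod 4 = 2 \<or> n mod 4 = 3"
    by linarith
  ultimately show ?case
    using Suc by (auto simp: mod_Suc)
qed simp

lemma card_total_dominating_set_ge:
  assumes "total_dominating_set (cycle_graph n) S"
  shows "total_domination_number_cycle n \<le> card S"
proof -
  have dom: "\<exists>u\<in>S. (v, u) \<in> parcs (cycle_graph n)" if "v \<in> {1..n}" for v
    using assms that by (auto simp: total_dominating_set_def)
  have "S \<subseteq> {1..n}"
    using assms by (auto simp: total_dominating_set_def)
  then have fin: "finite S"
    by (rule finite_subset) simp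
  have half: "n \<le> 2 * card S"
    using card_dominated_le[OF fin, of "{1..n}" n] dom by simp
  show ?thesis
  proof (cases "n mod 4 = 2")
    case True
    define k where "k = n div 4"
    have k: "n = 4 * k + 2"
      using True div_mult_mod_eq[of n 4] by (simp add: k_def)
    then have "even n"
      by simp
    note parity = cycle_graph_arc_parity[OF this]
    have "\<exists>u\<in>{u \<in> S. even u}. (v, u) \<in> parcs (cycle_graph n)" if "v \<in> {v \<in> {1..n}. odd v}" for v
      using dom[of v] parity that by blast
    then have "card {v \<in> {1..n}. odd v} \<le> 2 * card {u \<in> S. even u}"
      using fin by (intro card_dominated_le) simp_all
    \<comment> \<open>There are \<open>2 * k + 1\<close> odd vertices, so halving rounds up.
      Rounding up once in each class gains one over the bound \<open>half\<close>.\<close>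
    then have "k + 1 \<le> card {u \<in> S. even u}"
      unfolding card_odd_interval using k by simp
    moreover
    have "\<exists>u\<in>{u \<in> S. odd u}. (v, u) \<in> parcs (cycle_graph n)" if "v \<in> {v \<in> {1..n}. even v}" for v
      using dom[of v] parity that by blast
    then have "card {v \<in> {1..n}. even v} \<le> 2 * card {u \<in> S. odd u}"
      using fin by (intro card_dominated_le) simp_all
    then have "k + 1 \<le> card {u \<in> S. odd u}"
      unfolding card_even_interval using k by simp
    moreover have "card S = card {u \<in> S. even u} + card {u \<in> S. odd u}"
    proof -
      have "S = {u \<in> S. even u} \<union> {u \<in> S. odd u}"
        by blast
      also have "card \<dots> = card {u \<in> S. even u} + card {u \<in> S. odd u}"
        using fin by (intro card_Un_disjoint) auto
      finally show ?thesis .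
    qed
    moreover have "2 * total_domination_number_cycle n = n + 2"
      using True by (simp add: twice_total_domination_number_cycle)
    ultimately show ?thesis
      using k by linarith
  next
    case False
    \<comment> \<open>The excess of 1 over \<open>half\<close> vanishes because both doubled
      quantities are even.\<close>
    then have "2 * total_domination_number_cycle n \<le> n + 1"
      by (simp add: twice_total_domination_number_cycle)
    with half show ?thesis
      by linarith
  qed
qed

section \<open>A small TDS through a given vertex\<close>

lemma ex_total_dominating_set:
  assumes "n \<ge> 3" and "i \<in> {1..n}"
  obtains S where "total_dominating_set (cycle_graph n) S" "i \<in> S"
    "card S \<le> total_domination_number_cycle n"
proof
  \<comment> \<open>\<open>f j\<close> is the vertex reached from \<open>i\<close> after
    \<open>j\<close> steps around the cycle; the shift by 1 translates between residues and the
    vertices \<open>{1..n}\<close>.\<close>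
  define f where "f j = (i - 1 + j) mod n + 1" for j
  define B where "B = {j. j < n \<and> j mod 4 < 2}"
  have f_range: "f j \<in> {1..n}" for j
    using assms by (simp add: f_def Suc_le_eq)
  have f_mod: "f (j mod n) = f j" for j
    by (simp add: f_def mod_add_right_eq)
  have "f (Suc j) = f j mod n + 1" for j
    by (simp add: f_def mod_Suc_eq)
  then have succ: "(f j, f (Suc j)) \<in> parcs (cycle_graph n)" for j
    using cycle_graph_arc_successor[OF f_range] by metis
  have f_surj: "\<exists>j<n. f j = v" if "v \<in> {1..n}" for v
  proof -
    \<comment> \<open>Adding \<open>n\<close> first keeps the natural-number subtraction of
      \<open>i\<close> from truncating.\<close>
    have "i - 1 + (v + n - i) = v - 1 + n"
      using assms that by auto
    then have "f (v + n - i) = (v - 1) mod n + 1"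
      by (simp only: f_def mod_add_self2)
    also have "\<dots> = v"
      using that by auto
    finally have "f (v + n - i) = v" .
    then show ?thesis
      using f_mod[of "v + n - i"] assms by (intro exI[of _ "(v + n - i) mod n"]) auto
  qed
  have dom: "\<exists>u\<in>f ` B. (f j, u) \<in> parcs (cycle_graph n)" if "j < n" for j
  proof (cases "j mod 4 = 0 \<or> j mod 4 = 3")
    case True
    then have "Suc j mod 4 < 2"
      by presburger
    \<comment> \<open>If the walk closes up here, the next position is 0, which belongs to
      \<open>B\<close> whatever \<open>n\<close> is modulo 4.\<close>
    then have "Suc j mod n \<in> B"
      using that by (cases "Suc j = n") (auto simp: B_def)
    then show ?thesis
      using succ[of j] f_mod[of "Suc j"] by (metis imageI)
  next
    case False
    \<comment> \<open>The residue of \<open>j\<close> is now 1 or 2, so \<open>j\<close> is positive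
      and its predecessor, of residue 0 or 1, is reached without wrapping around.\<close>
    then obtain k where k: "j = Suc k"
      by (cases j) auto
    with False have "k mod 4 < 2"
      by presburger
    then have "k \<in> B"
      using k that by (simp add: B_def)
    then show ?thesis
      using cycle_graph_arc_sym[OF succ[of k]] k by blast
  qed
  show "total_dominating_set (cycle_graph n) (f ` B)"
    unfolding total_dominating_set_def pverts_cycle_graph using f_range f_surj dom by blast
  have "f 0 = i" "0 \<in> B"
    using assms by (auto simp: f_def B_def)
  then show "i \<in> f ` B"
    by blast
  have "card (f ` B) \<le> card B"
    by (rule card_image_le) (simp add: B_def)
  then show "card (f ` B) \<le> total_domination_number_cycle n"
    by (simp add: B_def total_domination_number_cycle_def)
qed

section \<open>Minimal TDSs and the total domination degree\<close>

lemma ex_minimal_TDS: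
  assumes "n \<ge> 3" and "i \<in> {1..n}"
  obtains S where "minimal_TDS (cycle_graph n) S" "i \<in> S"
    "card S = total_domination_number_cycle n"
proof -
  obtain S where S: "total_dominating_set (cycle_graph n) S" "i \<in> S"
    and le: "card S \<le> total_domination_number_cycle n"
    using ex_total_dominating_set[OF assms] .
  have "finite S"
    using S(1) by (auto simp: total_dominating_set_def intro: finite_subset)
  \<comment> \<open>A proper subset of the finite set \<open>S\<close> has fewer elements than the
    lower bound allows.\<close>
  then have "\<not> total_dominating_set (cycle_graph n) T" if "T \<subset> S" for T
    using psubset_card_mono[OF _ that] le card_total_dominating_set_ge[of n T] by linarith
  moreover have "card S = total_domination_number_cycle n"
    using le card_total_dominating_set_ge[OF S(1)] by simp
  ultimately show ?thesis
    using that S by (auto simp: minimal_TDS_def)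
qed

text \<open>The lower bound holds for every TDS, hence for every MTDS, and an MTDS through
  \<open>i\<close> attains it. Finiteness, which \<open>Min\<close> requires, holds because all
  these sets lie in \<open>{1..n}\<close>.\<close>

lemma total_domination_degree_cycle_graph:
  assumes "n \<ge> 3" and "i \<in> {1..n}"
  shows "total_domination_degree (cycle_graph n) i = total_domination_number_cycle n"
  unfolding total_domination_degree_def
proof (rule Min_eqI)
  have "{card S | S. minimal_TDS (cycle_graph n) S \<and> i \<in> S} \<subseteq> card ` Pow {1..n}"
    by (auto simp: minimal_TDS_def total_dominating_set_def)
  then show "finite {card S | S. minimal_TDS (cycle_graph n) S \<and> i \<in> S}"
    by (rule finite_subset) simp
  obtain S where "minimal_TDS (cycle_graph n) S" "i \<in> S"
    "card S = total_domination_number_cycle n"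
    using ex_minimal_TDS[OF assms] .
  then show "total_domination_number_cycle n \<in> {card S | S. minimal_TDS (cycle_graph n) S \<and> i \<in> S}"
    by (intro CollectI exI[of _ S]) simp
qed (auto simp: minimal_TDS_def intro: card_total_dominating_set_ge)

lemma compliant_graph_cycle_graph:
  assumes "n \<ge> 3"
  shows "compliant_graph (cycle_graph n)"
  unfolding compliant_graph_def
proof (intro conjI ballI)
  fix i assume "i \<in> pverts (cycle_graph n)"
  then have i: "i \<in> {1..n}"
    by simp
  obtain S where "minimal_TDS (cycle_graph n) S" "i \<in> S"
    using ex_minimal_TDS[OF assms i] .
  with i show "compliant_vertex (cycle_graph n) i"
    by (auto simp: compliant_vertex_def)
qed (simp_all add: assms pair_graph_cycle_graph no_isolated_vertices_cycle_graph)

theorem theorem5: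
  fixes n :: nat
  assumes "n \<ge> 3"
  shows "compliant_graph (cycle_graph n) \<and>
    (\<forall>i\<in>{1..n}.
       (n mod 4 = 0 \<longrightarrow>
          real (total_domination_degree (cycle_graph n) i) = real n / 2) \<and>
       (n mod 4 = 1 \<or> n mod 4 = 3 \<longrightarrow>
          real (total_domination_degree (cycle_graph n) i) = (real n + 1) / 2) \<and>
       (n mod 4 = 2 \<longrightarrow>
          real (total_domination_degree (cycle_graph n) i) = real n / 2 + 1))"
proof -
  let ?g = "total_domination_number_cycle n"
  \<comment> \<open>The doubled identity is moved to the reals before halving, so that no integer
    division arises.\<close>
  have "real (2 * ?g) = real (n + (if n mod 4 = 0 then 0 else if n mod 4 = 2 then 2 else 1))"
    by (simp only: twice_total_domination_number_cycle)
  then have "n mod 4 = 0 \<Longrightarrow> real ?g = real n / 2"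
    "n mod 4 = 1 \<or> n mod 4 = 3 \<Longrightarrow> real ?g = (real n + 1) / 2"
    "n mod 4 = 2 \<Longrightarrow> real ?g = real n / 2 + 1"
    by auto
  then show ?thesis
    using compliant_graph_cycle_graph[OF assms] total_domination_degree_cycle_graph[OF assms]
    by simp
qed

end
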